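(* Let $E$ be a finite set, let $(E,\mathcal{F})$ be a $k$-truncated antimatroid of rank $k$, and let $F:\mathcal{F}_{k-1}\to\mathbb{R}$ be a set function, where $\mathcal{F}_{k-1}=\{X\in\mathcal{F}:|X|\le k-1\}$. Then $F$ is quasi-concave if and only if there exists a monotone linkage function $\pi:E\times 2^{E}\to\mathbb{R}$ such that for every $X\in\mathcal{F}_{k-1}$, \[ F(X)=\min_{x\in\Gamma(X)}\pi(x,X). \]
   Context: A set system over a finite set $E$ is a pair $(E,\mathcal{F})$ with $\mathcal{F}\subseteq 2^{E}$; members of $\mathcal{F}$ are called feasible. A non-empty set system $(E,\mathcal{A})$ is an antimatroid if (A1) every non-empty $X\in\mathcal{A}$ contains some $x$ with $X-\{x\}\in\mathcal{A}$, and (A2) for all $X,Y\in\mathcal{A}$ with $X\not\subseteq Y$ there is $x\in X-Y$ with $Y\cup\{x\}\in\mathcal{A}$. The rank of a set system $(E,\mathcal{F})$ is $\max\{|Y|:Y\in\mathcal{F}\}$. A $k$-truncated antimatroid is a set system $(E,\mathcal{F})$ with $\mathcal{F}=\{X\in\mathcal{A}:|X|\le k\}$ for some antimatroid $(E,\mathcal{A})$; here it is assumed to have rank $k$ (i.e. $k$ is at most the rank of $\mathcal{A}$). For $X\in\mathcal{F}$, $\Gamma(X)=\{x\in E-X: X\cup\{x\}\in\mathcal{F}\}$ is the set of feasible continuations of $X$. A function $\pi:E\times 2^{E}\to\mathbb{R}$ is a monotone linkage function if for all $X\subseteq Y\subseteq E$ and $x\in E$, $\pi(x,X)\ge\pi(x,Y)$.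 A set function $F$ defined on $\mathcal{F}_{k-1}$ is quasi-concave if for all $X,Y\in\mathcal{F}_{k-1}$ and every maximal feasible subset $Z$ of $X\cap Y$ (i.e. maximal member of $\mathcal{F}$ contained in $X\cap Y$), $F(Z)\ge\min\{F(X),F(Y)\}$. *)

theory Defs
  imports Complex_Main
begin

definition set_system :: "'a set \<Rightarrow> 'a set set \<Rightarrow> bool" where
  "set_system E \<F> \<longleftrightarrow> finite E \<and> \<F> \<subseteq> Pow E"

definition antimatroid :: "'a set \<Rightarrow> 'a set set \<Rightarrow> bool" where
  "antimatroid E \<A> \<longleftrightarrow>
     set_system E \<A> \<and> \<A> \<noteq> {} \<and>
     (\<forall>X\<in>\<A>. X \<noteq> {} \<longrightarrow> (\<exists>x\<in>X. X - {x} \<in> \<A>)) \<and>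
     (\<forall>X\<in>\<A>. \<forall>Y\<in>\<A>. \<not> X \<subseteq> Y \<longrightarrow> (\<exists>x\<in>X - Y. Y \<union> {x} \<in> \<A>))"

definition set_system_rank :: "'a set set \<Rightarrow> nat" where
  "set_system_rank \<F> = Max (card ` \<F>)"

definition truncated_antimatroid :: "nat \<Rightarrow> 'a set \<Rightarrow> 'a set set \<Rightarrow> bool" where
  "truncated_antimatroid k E \<F> \<longleftrightarrow>
     set_system E \<F> \<and> (\<exists>\<A>. antimatroid E \<A> \<and> \<F> = {X \<in> \<A>. card X \<le> k})"

(* This is the family of feasible sets of size at most k - 1. The strict inequality avoids
   truncated subtraction on nat: for k = 0 the family is empty. *)
definition feasible_below :: "nat \<Rightarrow> 'a set set \<Rightarrow> 'a set set" where
  "feasible_below k \<F> = {X \<in> \<F>. card X < k}"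

definition continuations :: "'a set \<Rightarrow> 'a set set \<Rightarrow> 'a set \<Rightarrow> 'a set" where
  "continuations E \<F> X = {x \<in> E - X. X \<union> {x} \<in> \<F>}"

definition monotone_linkage :: "'a set \<Rightarrow> ('a \<Rightarrow> 'a set \<Rightarrow> real) \<Rightarrow> bool" where
  "monotone_linkage E \<pi> \<longleftrightarrow>
     (\<forall>X Y. \<forall>x\<in>E. X \<subseteq> Y \<and> Y \<subseteq> E \<longrightarrow> \<pi> x X \<ge> \<pi> x Y)"

definition maximal_feasible_subset :: "'a set set \<Rightarrow> 'a set \<Rightarrow> 'a set \<Rightarrow> bool" where
  "maximal_feasible_subset \<F> S Z \<longleftrightarrow>
     Z \<in> \<F> \<and> Z \<subseteq> S \<and> (\<forall>W\<in>\<F>. W \<subseteq> S \<and> Z \<subseteq> W \<longrightarrow> W = Z)"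

definition quasi_concave :: "nat \<Rightarrow> 'a set set \<Rightarrow> ('a set \<Rightarrow> real) \<Rightarrow> bool" where
  "quasi_concave k \<F> F \<longleftrightarrow>
     (\<forall>X\<in>feasible_below k \<F>. \<forall>Y\<in>feasible_below k \<F>. \<forall>Z.
        maximal_feasible_subset \<F> (X \<inter> Y) Z \<longrightarrow> F Z \<ge> min (F X) (F Y))"

end

theory Submission
  imports Defs
begin

text \<open>
  If \<open>F\<close> is given by a monotone linkage function \<open>\<pi>\<close> and \<open>Z\<close> is maximal feasible in \<open>X \<inter> Y\<close>,
  then a minimiser \<open>x\<close> of \<open>\<pi> \<cdot> Z\<close> lies outside \<open>X\<close>, say; it is a continuation of \<open>X\<close> by (A2),
  so \<open>F X \<le> \<pi> x X \<le> \<pi> x Z = F Z\<close>.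
  Conversely, let \<open>\<pi> x X\<close> be the maximum of \<open>F A\<close> over the feasible sets \<open>A \<supseteq> X\<close> avoiding \<open>x\<close>.
  If \<open>\<pi> x X > F X\<close> for all continuations \<open>x\<close>, choose \<open>A \<supseteq> X\<close> with \<open>F A > F X\<close> of least size:
  it contains a continuation \<open>x\<close> of \<open>X\<close>, and intersecting \<open>A\<close> with a set witnessing
  \<open>\<pi> x X > F X\<close> yields, by quasi-concavity, a smaller such set.
\<close>

lemma truncated_antimatroid_finite:
  assumes "truncated_antimatroid k E \<F>"
  shows "finite E" "finite \<F>" "\<And>X. X \<in> \<F> \<Longrightarrow> X \<subseteq> E" "\<And>X. X \<in> \<F> \<Longrightarrow> finite X"
proof -
  have "finite E" and sub: "\<F> \<subseteq> Pow E"
    using assms by (auto simp: truncated_antimatroid_def set_system_def)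
  then show "finite E" "finite \<F>" "\<And>X. X \<in> \<F> \<Longrightarrow> X \<subseteq> E" "\<And>X. X \<in> \<F> \<Longrightarrow> finite X"
    by (auto intro: finite_subset)
qed

text \<open>(A2) survives truncation because \<open>Y\<close> has fewer than \<open>k\<close>
  elements, so the one-element extension found in the antimatroid still has size at most
  \<open>k\<close>.\<close>

lemma truncated_antimatroid_augment:
  assumes trunc: "truncated_antimatroid k E \<F>"
    and X: "X \<in> \<F>" and Y: "Y \<in> feasible_below k \<F>" and "\<not> X \<subseteq> Y"
  obtains x where "x \<in> X - Y" "x \<in> continuations E \<F> Y"
proof -
  obtain \<A> where \<A>: "antimatroid E \<A>" and \<F>: "\<F> = {X \<in> \<A>. card X \<le> k}"
    using trunc by (auto simp: truncated_antimatroid_def)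
  have Y': "Y \<in> \<F>" "card Y < k" using Y by (auto simp: feasible_below_def)
  have "X \<in> \<A>" "Y \<in> \<A>" using X Y' \<F> by auto
  with \<A> \<open>\<not> X \<subseteq> Y\<close> obtain x where x: "x \<in> X - Y" "Y \<union> {x} \<in> \<A>"
    unfolding antimatroid_def by blast
  have "card (Y \<union> {x}) \<le> k"
    using x(1) Y' truncated_antimatroid_finite(4)[OF trunc Y'(1)] by simp
  then have "Y \<union> {x} \<in> \<F>" using x \<F> by simp
  moreover have "x \<in> E" using x(1) X truncated_antimatroid_finite(3)[OF trunc] by blast
  ultimately show thesis using that x(1) by (simp add: continuations_def)
qed

text \<open>A feasible set of size \<open>k\<close> exists by the rank hypothesis and is too large
  to lie in \<open>Y\<close>, so augmentation applies. This makes every \<open>Min\<close> over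
  continuations a genuine minimum.\<close>

lemma continuations_nonempty:
  assumes trunc: "truncated_antimatroid k E \<F>" and rank: "set_system_rank \<F> = k"
    and Y: "Y \<in> feasible_below k \<F>"
  shows "continuations E \<F> Y \<noteq> {}"
proof -
  have Y': "Y \<in> \<F>" "card Y < k" using Y by (auto simp: feasible_below_def)
  have "Max (card ` \<F>) \<in> card ` \<F>"
    using Y' truncated_antimatroid_finite(2)[OF trunc] by (intro Max_in) auto
  then obtain B where B: "B \<in> \<F>" "card B = k"
    using rank by (auto simp: set_system_rank_def)
  have "\<not> B \<subseteq> Y"
    using B Y' card_mono[OF truncated_antimatroid_finite(4)[OF trunc Y'(1)], of B] by linarith
  with truncated_antimatroid_augment[OF trunc B(1) Y] show ?thesis by blast
qed

lemma finite_continuations: "finite E \<Longrightarrow> finite (continuations E \<F> X)"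
  by (simp add: continuations_def)

lemma maximal_feasible_subset_exists:
  assumes "finite \<F>" "X \<in> \<F>" "X \<subseteq> S"
  obtains Z where "maximal_feasible_subset \<F> S Z" "X \<subseteq> Z"
proof -
  have "finite {W \<in> \<F>. W \<subseteq> S}" "X \<in> {W \<in> \<F>. W \<subseteq> S}" using assms by auto
  from finite_has_maximal2[OF this] obtain Z where
    "Z \<in> \<F>" "Z \<subseteq> S" "X \<subseteq> Z" "\<forall>W \<in> {W \<in> \<F>. W \<subseteq> S}. Z \<subseteq> W \<longrightarrow> Z = W" by auto
  then show thesis by (intro that[of Z]) (auto simp: maximal_feasible_subset_def)
qed

lemma quasi_concave_if_linkage:
  assumes trunc: "truncated_antimatroid k E \<F>" and rank: "set_system_rank \<F> = k"
    and mono: "monotone_linkage E \<pi>"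
    and F: "\<And>X. X \<in> feasible_below k \<F> \<Longrightarrow> F X = Min ((\<lambda>x. \<pi> x X) ` continuations E \<F> X)"
  shows "quasi_concave k \<F> F"
  unfolding quasi_concave_def
proof (intro ballI allI impI)
  note fin = truncated_antimatroid_finite[OF trunc]
  fix X Y Z
  assume X: "X \<in> feasible_below k \<F>" and Y: "Y \<in> feasible_below k \<F>"
    and Z: "maximal_feasible_subset \<F> (X \<inter> Y) Z"
  have Z': "Z \<in> \<F>" "Z \<subseteq> X" "Z \<subseteq> Y" using Z by (auto simp: maximal_feasible_subset_def)
  have "card Z \<le> card X"
    using Z' X fin(4) by (intro card_mono) (auto simp: feasible_below_def)
  then have Zk: "Z \<in> feasible_below k \<F>" using Z' X by (simp add: feasible_below_def)
  have "F Z \<in> (\<lambda>x. \<pi> x Z) ` continuations E \<F> Z"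
    unfolding F[OF Zk] using finite_continuations[OF fin(1)] continuations_nonempty[OF trunc rank Zk]
    by (intro Min_in) auto
  then obtain x where x: "x \<in> continuations E \<F> Z" "F Z = \<pi> x Z" by auto
  have xZ: "x \<notin> Z" "Z \<union> {x} \<in> \<F>" "x \<in> E" using x by (auto simp: continuations_def)
  \<comment> \<open>Only \<open>x\<close> can lie in \<open>Z \<union> {x}\<close> but outside
    \<open>W\<close>, so augmenting \<open>W\<close> from this set must add
    \<open>x\<close>.\<close>
  have le: "F W \<le> F Z" if W: "W \<in> feasible_below k \<F>" and sub: "Z \<subseteq> W" and xW: "x \<notin> W" for W
  proof -
    have "x \<in> continuations E \<F> W"
      using truncated_antimatroid_augment[OF trunc xZ(2) W] sub xW by blast
    then have "F W \<le> \<pi> x W"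
      unfolding F[OF W] using finite_continuations[OF fin(1)] by (intro Min_le) auto
    also have "\<pi> x W \<le> \<pi> x Z"
      using mono sub W fin(3) xZ(3) by (auto simp: monotone_linkage_def feasible_below_def)
    finally show ?thesis using x by simp
  qed
  have "\<not> Z \<union> {x} \<subseteq> X \<inter> Y"
    using Z xZ(1,2) unfolding maximal_feasible_subset_def by blast
  then have "x \<notin> X \<or> x \<notin> Y" using Z'(2,3) by blast
  then have "F X \<le> F Z \<or> F Y \<le> F Z" using le[OF X Z'(2)] le[OF Y Z'(3)] by blast
  then show "min (F X) (F Y) \<le> F Z" by linarith
qed

text \<open>
  The minimum of \<open>F\<close> is a default value that keeps the maximum monotone in \<open>X\<close> when no feasible
  set contains \<open>X\<close> and avoids \<open>x\<close>.
\<close>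

definition canonical_linkage :: "nat \<Rightarrow> 'a set set \<Rightarrow> ('a set \<Rightarrow> real) \<Rightarrow> 'a \<Rightarrow> 'a set \<Rightarrow> real" where
  "canonical_linkage k \<F> F x X =
     Max (insert (Min (F ` feasible_below k \<F>)) (F ` {A \<in> feasible_below k \<F>. X \<subseteq> A \<and> x \<notin> A}))"

lemma finite_feasible_below: "finite \<F> \<Longrightarrow> finite (feasible_below k \<F>)"
  by (simp add: feasible_below_def)

lemma monotone_canonical_linkage:
  assumes "finite \<F>"
  shows "monotone_linkage E (canonical_linkage k \<F> F)"
  unfolding monotone_linkage_def canonical_linkage_def
  using finite_feasible_below[OF assms] by (auto intro!: Max_mono)

lemma canonical_linkage_ge:
  assumes "finite \<F>" "A \<in> feasible_below k \<F>" "X \<subseteq> A" "x \<notin> A"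
  shows "F A \<le> canonical_linkage k \<F> F x X"
  unfolding canonical_linkage_def
  using assms finite_feasible_below[OF assms(1)] by (intro Max_ge) auto

text \<open>The default value is at most \<open>F X\<close>, so a maximum exceeding
  \<open>F X\<close> is attained at an actual feasible set.\<close>

lemma canonical_linkage_greaterE:
  assumes "finite \<F>" "X \<in> feasible_below k \<F>" "F X < canonical_linkage k \<F> F x X"
  obtains A where "A \<in> feasible_below k \<F>" "X \<subseteq> A" "x \<notin> A" "F X < F A"
proof -
  have "Min (F ` feasible_below k \<F>) \<le> F X"
    using assms finite_feasible_below by (intro Min_le) auto
  then show thesis
    using assms(3) that finite_feasible_below[OF assms(1)]
    unfolding canonical_linkage_def by (subst (asm) Max_gr_iff) auto
qed

lemma quasi_concave_canonical_linkage:
  assumes trunc: "truncated_antimatroid k E \<F>" and rank: "set_system_rank \<F> = k"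
    and qc: "quasi_concave k \<F> F" and X: "X \<in> feasible_below k \<F>"
  shows "F X = Min ((\<lambda>x. canonical_linkage k \<F> F x X) ` continuations E \<F> X)"
proof -
  note fin = truncated_antimatroid_finite[OF trunc]
  note cont = finite_continuations[OF fin(1), of \<F> X] continuations_nonempty[OF trunc rank X]
  have X': "X \<in> \<F>" using X by (simp add: feasible_below_def)
  \<comment> \<open>\<open>X\<close> avoids each of its continuations, so it is itself among the
    sets in the maximum.\<close>
  have ge: "F X \<le> canonical_linkage k \<F> F x X" if "x \<in> continuations E \<F> X" for x
    using that X by (intro canonical_linkage_ge[OF fin(2)]) (auto simp: continuations_def)
  have "\<exists>x\<in>continuations E \<F> X. canonical_linkage k \<F> F x X \<le> F X"
  proof (rule ccontr)
    assume "\<not> ?thesis"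
    then have avoid: "\<exists>A. A \<in> feasible_below k \<F> \<and> X \<subseteq> A \<and> x \<notin> A \<and> F X < F A"
      if "x \<in> continuations E \<F> X" for x
      using that canonical_linkage_greaterE[OF fin(2) X] by (metis not_le)
    define P where "P A \<longleftrightarrow> A \<in> feasible_below k \<F> \<and> X \<subseteq> A \<and> F X < F A" for A
    have "\<exists>A. P A" using avoid cont(2) by (auto simp: P_def)
    then obtain A where A: "P A" and least: "\<And>B. P B \<Longrightarrow> card A \<le> card B"
      using arg_min_nat_lemma[of P _ card] by blast
    have A': "A \<in> feasible_below k \<F>" "A \<in> \<F>" "X \<subseteq> A" "F X < F A"
      using A by (auto simp: P_def feasible_below_def)
    then have "\<not> A \<subseteq> X" by auto
    from truncated_antimatroid_augment[OF trunc A'(2) X this]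
    obtain x where x: "x \<in> A" "x \<in> continuations E \<F> X" by blast
    obtain B where B: "B \<in> feasible_below k \<F>" "X \<subseteq> B" "x \<notin> B" "F X < F B"
      using avoid[OF x(2)] by blast
    \<comment> \<open>Since \<open>X\<close> is feasible and lies in \<open>A \<inter> B\<close>,
      the maximal set can be chosen above \<open>X\<close>, as \<open>P Z\<close> requires.\<close>
    obtain Z where Z: "maximal_feasible_subset \<F> (A \<inter> B) Z" "X \<subseteq> Z"
      using maximal_feasible_subset_exists[OF fin(2) X', of "A \<inter> B"] A' B by blast
    have "min (F A) (F B) \<le> F Z" using qc A' B Z by (auto simp: quasi_concave_def)
    then have FZ: "F X < F Z" using A' B by linarith
    \<comment> \<open>The inclusion is strict because \<open>x\<close> is in \<open>A\<close> but
      not in \<open>B\<close>.\<close>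
    have Z': "Z \<in> \<F>" "Z \<subset> A" using Z B x by (auto simp: maximal_feasible_subset_def)
    have less: "card Z < card A" using Z' A' fin(4) by (simp add: psubset_card_mono)
    then have "P Z" using FZ Z Z' A' by (auto simp: P_def feasible_below_def)
    with least less show False by fastforce
  qed
  then obtain x where "x \<in> continuations E \<F> X" "canonical_linkage k \<F> F x X = F X"
    using ge by force
  then show ?thesis using cont ge by (intro Min_eqI[symmetric]) force+
qed

theorem theorem2:
  fixes E :: "'a set" and \<F> :: "'a set set" and k :: nat and F :: "'a set \<Rightarrow> real"
  assumes "finite E"
    and "truncated_antimatroid k E \<F>"
    and "set_system_rank \<F> = k"
  shows "quasi_concave k \<F> F \<longleftrightarrow>
    (\<exists>\<pi>. monotone_linkage E \<pi> \<and>
      (\<forall>X\<in>feasible_below k \<F>. F X = Min ((\<lambda>x. \<pi> x X) ` continuations E \<F> X)))"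
proof
  assume "quasi_concave k \<F> F"
  then show "\<exists>\<pi>. monotone_linkage E \<pi> \<and>
      (\<forall>X\<in>feasible_below k \<F>. F X = Min ((\<lambda>x. \<pi> x X) ` continuations E \<F> X))"
    using monotone_canonical_linkage[OF truncated_antimatroid_finite(2)[OF assms(2)]]
      quasi_concave_canonical_linkage[OF assms(2,3)] by blast
next
  assume "\<exists>\<pi>. monotone_linkage E \<pi> \<and>
      (\<forall>X\<in>feasible_below k \<F>. F X = Min ((\<lambda>x. \<pi> x X) ` continuations E \<F> X))"
  then show "quasi_concave k \<F> F"
    using quasi_concave_if_linkage[OF assms(2,3)] by blast
qed

end
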